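(* Let $n\ge 4$ and write $n=2k+3+s$ with $k$ a nonnegative integer and $s\in\{0,1\}$. Let $c(u,v;\mathcal{L}_n)$ denote the number of shortest paths from $u$ to $v$ in the Alternate Lucas cube $\mathcal{L}_n$. Then $$c(0^s(10)^k100,\,1^s(01)^k001;\mathcal{L}_n)=c(0^s(10)^k100,\,1^s(01)^k010;\mathcal{L}_n)=E_{n-1},$$ $$c(0^s(10)^k001,\,1^s(01)^k010;\mathcal{L}_n)=c(0^s(10)^k010,\,1^s(01)^k001;\mathcal{L}_n)=\binom{n-1}{2}E_{n-3},$$ where $E_m$ denotes the $m$th Euler number.
   Context: For $n\ge1$, the hypercube $Q_n$ has vertex set $B_n=\{b_1\cdots b_n: b_i\in\{0,1\}\}$, two strings adjacent iff they differ in exactly one coordinate. For $n\ge3$, the Alternate Lucas cube $\mathcal{L}_n$ is the subgraph of $Q_n$ induced by the binary strings $b_1\cdots b_n$ with $b_ib_{i+1}=0$ for all $i\in\{1,\dots,n-1\}$ and additionally $b_{n-2}b_n=0$. $0^s$, $1^s$ denote $s$ repeated symbols and $(10)^k$ the string $10$ repeated $k$ times. A permutation $\sigma_1\cdots\sigma_m$ of $\{1,\dots,m\}$ is alternating if $\sigma_1>\sigma_2<\sigma_3>\sigma_4<\cdots$; the Euler number $E_m$ is the number of alternating permutations of $\{1,\dots,m\}$ (with $E_0=1$), so $E_1=1,E_2=1,E_3=2,E_4=5,E_5=16$; equivalently $\sum_{m\ge0}E_mx^m/m!=\sec x+\tan x$. *)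

theory Defs
  imports
    "Graph_Theory.Graph_Theory"
    "HOL-Combinatorics.Permutations"
    "HOL-Library.Z2"
begin

text \<open>
  Binary strings are lists over the two-element type \<^typ>\<open>bit\<close>; as lists are indexed from 0,
  the letter \<open>b\<^sub>i\<close> of \<open>b = b\<^sub>1\<dots>b\<^sub>n\<close> is \<open>b ! (i - 1)\<close>.
  Undirected graphs are symmetric digraphs, each edge being a pair of opposite arcs.
\<close>

definition hypercube :: "nat \<Rightarrow> bit list pair_pre_digraph" where
  "hypercube n =
    \<lparr> pverts = {b. length b = n},
      parcs = {(b, c). length b = n \<and> length c = n \<and> (\<exists>!i. i < n \<and> b ! i \<noteq> c ! i)} \<rparr>"

text \<open>Meaningful for \<open>n \<ge> 3\<close> only.\<close>

definition alternate_lucas_strings :: "nat \<Rightarrow> bit list set" where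
  "alternate_lucas_strings n =
    {b. length b = n \<and> (\<forall>i\<in>{1..n - 1}. b ! (i - 1) * b ! i = 0) \<and> b ! (n - 3) * b ! (n - 1) = 0}"

definition alternate_lucas_cube :: "nat \<Rightarrow> (bit list, bit list \<times> bit list) pre_digraph" where
  "alternate_lucas_cube n = with_proj (hypercube n) \<restriction> alternate_lucas_strings n"

definition num_shortest_paths :: "'a \<Rightarrow> 'a \<Rightarrow> ('a, 'b) pre_digraph \<Rightarrow> nat" where
  "num_shortest_paths u v G = card {p. is_arg_min length (\<lambda>q. pre_digraph.apath G u q v) p}"

text \<open>
  A permutation of \<open>{1,\<dots>,m}\<close> is a function that is the identity elsewhere, so that
  \<open>E\<^sub>0 = 1\<close> counts the identity.
\<close>

definition alternating_perms :: "nat \<Rightarrow> (nat \<Rightarrow> nat) set" where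
  "alternating_perms m =
    {\<sigma>. \<sigma> permutes {1..m} \<and>
        (\<forall>i\<in>{1..<m}. if odd i then \<sigma> i > \<sigma> (i + 1) else \<sigma> i < \<sigma> (i + 1))}"

definition euler_number :: "nat \<Rightarrow> nat" where
  "euler_number m = card (alternating_perms m)"

end

theory Submission
  imports Defs
begin

text \<open>
  A path of Hamming length from \<open>u\<close> to \<open>v\<close> is an ordering of the positions where they differ; it
  stays in the cube iff, for any two conflicting positions, the one that is erased is flipped
  before the one that is created. So the shortest paths are the linear extensions of a relation on
  positions. In the first two cases that relation is a zigzag on \<open>n - 1\<close> positions, whose linear
  extensions are the alternating permutations. In the last two it is a zigzag on \<open>n - 3\<close> positions
  together with an independent two-element chain, and shuffling gives the binomial factor.
\<close>

section \<open>Linear extensions\<close>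

text \<open>\<open>r\<close> lists direct constraints only and need not be transitive. For distinct
  \<open>x\<close> and \<open>y\<close>, forbidding \<open>r y x\<close> when \<open>x\<close> is
  listed first amounts to listing \<open>x\<close> before \<open>y\<close> whenever
  \<open>r x y\<close>; contradictory constraints give the empty set.\<close>

definition linear_extensions :: "'a set \<Rightarrow> ('a \<Rightarrow> 'a \<Rightarrow> bool) \<Rightarrow> 'a list set" where
  "linear_extensions D r =
    {xs. distinct xs \<and> set xs = D \<and> sorted_wrt (\<lambda>x y. \<not> r y x) xs}"

lemma sorted_wrt_iff_on_set:
  assumes "\<And>x y. x \<in> set xs \<Longrightarrow> y \<in> set xs \<Longrightarrow> P x y \<longleftrightarrow> Q x y"
  shows "sorted_wrt P xs \<longleftrightarrow> sorted_wrt Q xs"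
  using assms by (induction xs) auto

lemma length_linear_extension: "xs \<in> linear_extensions D r \<Longrightarrow> length xs = card D"
  unfolding linear_extensions_def using distinct_card by fastforce

lemma finite_linear_extensions:
  assumes "finite D"
  shows "finite (linear_extensions D r)"
proof (rule finite_subset)
  show "linear_extensions D r \<subseteq> {xs. set xs \<subseteq> D \<and> length xs = card D}"
    using length_linear_extension[of _ D r] unfolding linear_extensions_def by blast
qed (rule finite_lists_length_eq[OF assms])

text \<open>Applying \<open>f\<close> to every entry carries one set of orderings onto the other.
  This later relabels positions of strings as the numbers \<open>1..m\<close>.\<close>

lemma card_linear_extensions_bij_betw:
  assumes "bij_betw f D D'"
    and "\<And>x y. x \<in> D \<Longrightarrow> y \<in> D \<Longrightarrow> r x y \<longleftrightarrow> r' (f x) (f y)"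
  shows "card (linear_extensions D r) = card (linear_extensions D' r')"
proof (rule bij_betw_same_card)
  have inj: "inj_on f D" and im: "f ` D = D'"
    using assms(1) by (auto simp: bij_betw_def)
  have sorted: "sorted_wrt (\<lambda>x y. \<not> r y x) xs \<longleftrightarrow> sorted_wrt (\<lambda>x y. \<not> r' y x) (map f xs)"
    if "set xs = D" for xs
    unfolding sorted_wrt_map
    by (rule sorted_wrt_iff_on_set) (use assms(2) that in simp)
  show "bij_betw (map f) (linear_extensions D r) (linear_extensions D' r')"
  proof (rule bij_betw_imageI)
    show "inj_on (map f) (linear_extensions D r)"
    proof (rule inj_onI)
      fix xs ys
      assume "xs \<in> linear_extensions D r" "ys \<in> linear_extensions D r" "map f xs = map f ys"
      then show "xs = ys"
        using map_inj_on[of f xs ys] inj by (simp add: linear_extensions_def)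
    qed
    show "map f ` linear_extensions D r = linear_extensions D' r'"
    proof (intro set_eqI iffI)
      fix ys assume "ys \<in> map f ` linear_extensions D r"
      then obtain xs where "xs \<in> linear_extensions D r" "ys = map f xs" by blast
      then show "ys \<in> linear_extensions D' r'"
        using sorted[of xs] im inj by (simp add: linear_extensions_def distinct_map)
    next
      fix ys assume ys: "ys \<in> linear_extensions D' r'"
      define xs where "xs = map (inv_into D f) ys"
      have "set ys = D'" "distinct ys" using ys by (auto simp: linear_extensions_def)
      then have "map f xs = ys"
        using im by (auto simp: xs_def f_inv_into_f intro!: map_idI)
      moreover have set: "set xs = D"
        using \<open>set ys = D'\<close> im inj inv_into_image_cancel[OF inj subset_refl] by (simp add: xs_def)
      ultimately have "xs \<in> linear_extensions D r"
        using ys sorted[OF set] distinct_map[of f xs] by (simp add: linear_extensions_def)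
      then show "ys \<in> map f ` linear_extensions D r"
        using \<open>map f xs = ys\<close> by blast
    qed
  qed
qed

text \<open>List reversal exchanges the two sets. This makes the two orientations of a zigzag
  interchangeable.\<close>

lemma card_linear_extensions_converse:
  "card (linear_extensions D (\<lambda>x y. r y x)) = card (linear_extensions D r)"
proof (rule bij_betw_same_card)
  show "bij_betw rev (linear_extensions D (\<lambda>x y. r y x)) (linear_extensions D r)"
    by (rule bij_betw_byWitness[where f' = rev])
      (auto simp: linear_extensions_def sorted_wrt_rev)
qed

text \<open>Pairs split by \<open>P\<close> satisfy \<open>R\<close> in either order, so only pairs
  on the same side of \<open>P\<close> impose a condition.\<close>

lemma sorted_wrt_partition:
  assumes "\<And>x y. x \<in> set zs \<Longrightarrow> y \<in> set zs \<Longrightarrow> P x \<noteq> P y \<Longrightarrow> R x y"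
  shows "sorted_wrt R zs \<longleftrightarrow>
    sorted_wrt R (filter P zs) \<and> sorted_wrt R (filter (\<lambda>x. \<not> P x) zs)"
  using assms by (induction zs) auto

text \<open>Independence leaves the relative order of \<open>A\<close> and \<open>B\<close> free: an
  extension of the union is a shuffle of one extension of each part, and two disjoint lists of fixed
  lengths have a binomial number of shuffles.\<close>

lemma card_linear_extensions_Un:
  assumes fin: "finite A" "finite B" and disj: "A \<inter> B = {}"
    and indep: "\<And>x y. x \<in> A \<Longrightarrow> y \<in> B \<Longrightarrow> \<not> r x y \<and> \<not> r y x"
  shows "card (linear_extensions (A \<union> B) r) =
    ((card A + card B) choose card A) * card (linear_extensions A r) * card (linear_extensions B r)"
proof -
  let ?I = "linear_extensions A r \<times> linear_extensions B r"
  have sets: "set xs = A" "set ys = B" "distinct xs" "distinct ys" if "(xs, ys) \<in> ?I" for xs ys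
    using that by (auto simp: linear_extensions_def)
  have split: "sorted_wrt (\<lambda>x y. \<not> r y x) zs \<longleftrightarrow>
      sorted_wrt (\<lambda>x y. \<not> r y x) (filter (\<lambda>x. x \<in> A) zs) \<and>
      sorted_wrt (\<lambda>x y. \<not> r y x) (filter (\<lambda>x. x \<notin> A) zs)" if "set zs = A \<union> B" for zs
    by (rule sorted_wrt_partition) (use that indep in auto)
  have "linear_extensions (A \<union> B) r = (\<Union>(xs, ys)\<in>?I. shuffles xs ys)"
  proof (intro set_eqI iffI)
    fix zs assume zs: "zs \<in> linear_extensions (A \<union> B) r"
    then have "(filter (\<lambda>x. x \<in> A) zs, filter (\<lambda>x. x \<notin> A) zs) \<in> ?I"
      using split[of zs] disj by (auto simp: linear_extensions_def)
    then show "zs \<in> (\<Union>(xs, ys)\<in>?I. shuffles xs ys)"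
      using partition_in_shuffles[of zs "\<lambda>x. x \<in> A"] by blast
  next
    fix zs assume "zs \<in> (\<Union>(xs, ys)\<in>?I. shuffles xs ys)"
    then obtain xs ys where I: "(xs, ys) \<in> ?I" and zs: "zs \<in> shuffles xs ys" by blast
    have set: "set zs = A \<union> B" "distinct zs"
      using set_shuffles[OF zs] distinct_disjoint_shuffles[OF _ _ _ zs] sets[OF I] disj by auto
    moreover have "filter (\<lambda>x. x \<in> A) zs = xs" "filter (\<lambda>x. x \<notin> A) zs = ys"
      using filter_shuffles_disjoint1[OF _ zs] sets[OF I] disj by auto
    ultimately show "zs \<in> linear_extensions (A \<union> B) r"
      using split[of zs] I by (auto simp: linear_extensions_def)
  qed
  also have "card \<dots> = (\<Sum>(xs, ys)\<in>?I. card (shuffles xs ys))"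
  proof (subst card_UN_disjoint, goal_cases)
    \<comment> \<open>Filtering by \<open>A\<close> recovers both lists from a shuffle, so different
      pairs have disjoint shuffle sets.\<close>
    case 3
    have "xs = xs' \<and> ys = ys'"
      if "(xs, ys) \<in> ?I" "(xs', ys') \<in> ?I" "zs \<in> shuffles xs ys" "zs \<in> shuffles xs' ys'"
      for xs ys xs' ys' zs
    proof -
      have "filter (\<lambda>x. x \<in> A) zs = xs" "filter (\<lambda>x. x \<notin> A) zs = ys"
        using filter_shuffles_disjoint1[OF _ that(3)] sets[OF that(1)] disj by auto
      moreover have "filter (\<lambda>x. x \<in> A) zs = xs'" "filter (\<lambda>x. x \<notin> A) zs = ys'"
        using filter_shuffles_disjoint1[OF _ that(4)] sets[OF that(2)] disj by auto
      ultimately show ?thesis by simp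
    qed
    then show ?case by fast
  qed (auto simp: fin finite_linear_extensions intro!: sum.cong)
  also have "\<dots> = (\<Sum>(xs, ys)\<in>?I. (card A + card B) choose card A)"
  proof (rule sum.cong[OF refl], clarify)
    fix xs ys assume "xs \<in> linear_extensions A r" "ys \<in> linear_extensions B r"
    then show "card (shuffles xs ys) = (card A + card B) choose card A"
      using sets[of xs ys] disj
      by (auto simp: card_disjoint_shuffles dest!: length_linear_extension)
  qed
  also have "\<dots> = ((card A + card B) choose card A) *
      card (linear_extensions A r) * card (linear_extensions B r)"
    by (simp add: card_cartesian_product)
  finally show ?thesis .
qed

section \<open>Euler numbers as counts of linear extensions\<close>

lemma sorted_wrt_upt:
  "sorted_wrt R [i..<j] \<longleftrightarrow> (\<forall>a\<in>{i..<j}. \<forall>b\<in>{i..<j}. a < b \<longrightarrow> R a b)" (is "_ \<longleftrightarrow> ?R")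
proof
  assume L: "sorted_wrt R [i..<j]"
  show ?R
  proof (intro ballI impI)
    fix a b assume "a \<in> {i..<j}" "b \<in> {i..<j}" "a < b"
    then show "R a b"
      using L[unfolded sorted_wrt_iff_nth_less, rule_format, of "a - i" "b - i"] by simp
  qed
qed (auto simp: sorted_wrt_iff_nth_less)

text \<open>A linear extension lists the elements in order of their values under the permutation.\<close>

lemma card_permutes_linear_extensions:
  fixes m :: nat
  assumes irrefl: "\<And>i. \<not> r i i"
  shows "card {\<sigma>. \<sigma> permutes {1..m} \<and> (\<forall>i\<in>{1..m}. \<forall>j\<in>{1..m}. r i j \<longrightarrow> \<sigma> i < \<sigma> j)} =
    card (linear_extensions {1..m} r)" (is "card ?P = _")
proof (rule bij_betw_same_card)
  let ?f = "\<lambda>\<sigma>. map (inv \<sigma>) [1..<Suc m]"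
  have set_upt: "set [1..<Suc m] = {1..m}" by auto
  have sorted: "sorted_wrt (\<lambda>x y. \<not> r y x) (?f \<sigma>) \<longleftrightarrow>
      (\<forall>i\<in>{1..m}. \<forall>j\<in>{1..m}. r i j \<longrightarrow> \<sigma> i < \<sigma> j)" if \<sigma>: "\<sigma> permutes {1..m}" for \<sigma>
  proof -
    have "sorted_wrt (\<lambda>x y. \<not> r y x) (?f \<sigma>) \<longleftrightarrow>
        (\<forall>a\<in>{1..m}. \<forall>b\<in>{1..m}. a < b \<longrightarrow> \<not> r (inv \<sigma> b) (inv \<sigma> a))"
      unfolding sorted_wrt_map sorted_wrt_upt by auto
    also have "\<dots> \<longleftrightarrow> (\<forall>i\<in>{1..m}. \<forall>j\<in>{1..m}. r i j \<longrightarrow> \<sigma> i < \<sigma> j)" (is "?L \<longleftrightarrow> ?R")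
    proof
      assume L: ?L
      show ?R
      proof (intro ballI impI)
        fix i j assume ij: "i \<in> {1..m}" "j \<in> {1..m}" "r i j"
        have "\<not> \<sigma> j < \<sigma> i"
          using L[rule_format, of "\<sigma> j" "\<sigma> i"] ij permutes_in_image[OF \<sigma>]
          by (auto simp: permutes_inverses[OF \<sigma>])
        \<comment> \<open>The list order only excludes \<open>\<sigma> j < \<sigma> i\<close>;
          irreflexivity forces \<open>i\<close> and \<open>j\<close> to differ, and injectivity then
          makes the inequality strict.\<close>
        moreover have "\<sigma> i \<noteq> \<sigma> j"
          using irrefl ij permutes_inj[OF \<sigma>] by (metis injD)
        ultimately show "\<sigma> i < \<sigma> j" by linarith
      qed
    next
      assume R: ?R
      show ?L
      proof (intro ballI impI notI)
        fix a b assume ab: "a \<in> {1..m}" "b \<in> {1..m}" "a < b" "r (inv \<sigma> b) (inv \<sigma> a)"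
        then show False
          using R[rule_format, of "inv \<sigma> b" "inv \<sigma> a"] permutes_in_image[OF permutes_inv[OF \<sigma>]]
          by (auto simp: permutes_inverses[OF \<sigma>])
      qed
    qed
    finally show ?thesis .
  qed
  show "bij_betw ?f ?P (linear_extensions {1..m} r)"
  proof (rule bij_betw_imageI)
    show "inj_on ?f ?P"
    proof (rule inj_onI)
      fix \<sigma> \<tau> assume "\<sigma> \<in> ?P" "\<tau> \<in> ?P" and eq: "?f \<sigma> = ?f \<tau>"
      then have \<sigma>: "\<sigma> permutes {1..m}" and \<tau>: "\<tau> permutes {1..m}" by auto
      have "inv \<sigma> x = inv \<tau> x" for x
      proof (cases "x \<in> {1..m}")
        case True
        then show ?thesis using eq set_upt by (metis map_eq_conv)
      next
        case False
        then show ?thesis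
          using permutes_not_in[OF permutes_inv[OF \<sigma>]] permutes_not_in[OF permutes_inv[OF \<tau>]] by simp
      qed
      then show "\<sigma> = \<tau>"
        using permutes_inv_inv[OF \<sigma>] permutes_inv_inv[OF \<tau>] by (metis ext)
    qed
    show "?f ` ?P = linear_extensions {1..m} r"
    proof (intro set_eqI iffI)
      fix xs assume "xs \<in> ?f ` ?P"
      then obtain \<sigma> where \<sigma>: "\<sigma> \<in> ?P" and xs: "xs = ?f \<sigma>" by blast
      have perm: "inv \<sigma> permutes {1..m}" using \<sigma> permutes_inv by auto
      have "distinct xs"
        unfolding xs distinct_map using permutes_inj_on[OF perm] by simp
      moreover have "set xs = {1..m}"
        unfolding xs set_map set_upt by (rule permutes_image[OF perm])
      ultimately show "xs \<in> linear_extensions {1..m} r"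
        using sorted[of \<sigma>] \<sigma> unfolding linear_extensions_def xs by blast
    next
      fix xs assume xs: "xs \<in> linear_extensions {1..m} r"
      have len: "length xs = m" using length_linear_extension[OF xs] by simp
      have set: "set xs = {1..m}" "distinct xs" using xs by (auto simp: linear_extensions_def)
      \<comment> \<open>\<open>\<tau>\<close> reads \<open>xs\<close> as one-line notation, with
        \<open>i - 1\<close> because lists are indexed from 0. As \<open>?f\<close> lists the values
        of an inverse, the preimage of \<open>xs\<close> is \<open>inv \<tau>\<close>.\<close>
      define \<tau> where "\<tau> i = (if i \<in> {1..m} then xs ! (i - 1) else i)" for i
      have bij: "bij_betw \<tau> {1..m} {1..m}"
      proof (rule bij_betw_imageI)
        show "inj_on \<tau> {1..m}"
          using set len by (auto intro!: inj_onI simp: \<tau>_def nth_eq_iff_index_eq)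
        have "\<tau> ` {1..m} = \<tau> ` Suc ` {..<m}"
          by (simp add: image_Suc_lessThan)
        also have "\<dots> = (!) xs ` {..<m}"
          unfolding image_image by (rule image_cong) (auto simp: \<tau>_def)
        also have "\<dots> = set xs"
          unfolding set_conv_nth using len by auto
        finally show "\<tau> ` {1..m} = {1..m}" using set by simp
      qed
      then have \<tau>: "\<tau> permutes {1..m}"
        by (rule bij_imp_permutes) (auto simp: \<tau>_def)
      have f: "?f (inv \<tau>) = xs"
        unfolding permutes_inv_inv[OF \<tau>]
        by (rule nth_equalityI) (auto simp: len \<tau>_def simp del: upt_Suc)
      have "sorted_wrt (\<lambda>x y. \<not> r y x) (?f (inv \<tau>))"
        using xs unfolding f linear_extensions_def by blast
      then have "inv \<tau> \<in> ?P"
        using sorted[OF permutes_inv[OF \<tau>]] permutes_inv[OF \<tau>] by blast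
      then show "xs \<in> ?f ` ?P" by (intro image_eqI) (simp_all only: f)
    qed
  qed
qed

text \<open>The strict order of the fence poset with the even numbers at the bottom.\<close>

definition even_before_odd :: "nat \<Rightarrow> nat \<Rightarrow> bool" where
  "even_before_odd i j \<longleftrightarrow> even i \<and> (j = Suc i \<or> i = Suc j)"

text \<open>Each alternation condition compares an even index with an odd neighbour and asks for the
  smaller value at the even one, so alternating permutations are the strictly order-preserving
  permutations of the fence.\<close>

lemma euler_number_linear_extensions:
  "euler_number m = card (linear_extensions {1..m} even_before_odd)"
proof -
  have "(\<forall>i\<in>{1..<m}. if odd i then \<sigma> i > \<sigma> (i + 1) else \<sigma> i < \<sigma> (i + 1)) \<longleftrightarrow>
      (\<forall>i\<in>{1..m}. \<forall>j\<in>{1..m}. even_before_odd i j \<longrightarrow> \<sigma> i < \<sigma> j)" (is "?L \<longleftrightarrow> ?R")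
    for \<sigma> :: "nat \<Rightarrow> nat"
  proof
    assume L: ?L
    show ?R
    proof (intro ballI impI)
      fix i j assume ij: "i \<in> {1..m}" "j \<in> {1..m}" "even_before_odd i j"
      then consider "even i" "j = Suc i" | "odd j" "i = Suc j" by (auto simp: even_before_odd_def)
      then show "\<sigma> i < \<sigma> j"
        using L[rule_format, of i] L[rule_format, of j] ij by cases auto
    qed
  next
    assume R: ?R
    show ?L
      using R by (auto simp: even_before_odd_def)
  qed
  then have "euler_number m = card {\<sigma>. \<sigma> permutes {1..m} \<and>
      (\<forall>i\<in>{1..m}. \<forall>j\<in>{1..m}. even_before_odd i j \<longrightarrow> \<sigma> i < \<sigma> j)}"
    unfolding euler_number_def alternating_perms_def by presburger
  then show ?thesis
    using card_permutes_linear_extensions[of even_before_odd m] by (simp add: even_before_odd_def)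
qed

section \<open>Shortest paths in subgraphs of the hypercube\<close>

definition flip :: "nat \<Rightarrow> bit list \<Rightarrow> bit list" where
  "flip i b = b[i := if b ! i = 1 then 0 else 1]"

definition differing :: "bit list \<Rightarrow> bit list \<Rightarrow> nat set" where
  "differing u v = {i. i < length u \<and> u ! i \<noteq> v ! i}"

primrec flip_path :: "bit list \<Rightarrow> nat list \<Rightarrow> (bit list \<times> bit list) list" where
  "flip_path u [] = []"
| "flip_path u (i # is) = (u, flip i u) # flip_path (flip i u) is"

text \<open>The start \<open>u\<close> is not tested for membership in \<open>S\<close>, only the
  strings reached by flips; where the start matters, its membership is assumed separately.\<close>

primrec flips_to :: "bit list set \<Rightarrow> bit list \<Rightarrow> nat list \<Rightarrow> bit list \<Rightarrow> bool" where
  "flips_to S u [] v \<longleftrightarrow> u = v"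
| "flips_to S u (i # is) v \<longleftrightarrow> i < length u \<and> flip i u \<in> S \<and> flips_to S (flip i u) is v"

lemma length_flip [simp]: "length (flip i b) = length b"
  by (simp add: flip_def)

lemma nth_flip_eq: "i < length b \<Longrightarrow> flip i b ! i = (if b ! i = 1 then 0 else 1)"
  by (simp add: flip_def)

lemma nth_flip_neq [simp]: "i \<noteq> j \<Longrightarrow> flip i b ! j = b ! j"
  by (simp add: flip_def)

text \<open>With two letters, a disagreement at \<open>i\<close> determines the new letter there, so
  being a neighbour means being a single flip.\<close>

lemma ex1_differing_iff_flip:
  assumes "length b = n" "length c = n"
  shows "(\<exists>!i. i < n \<and> b ! i \<noteq> c ! i) \<longleftrightarrow> (\<exists>i<n. c = flip i b)"
proof
  assume "\<exists>!i. i < n \<and> b ! i \<noteq> c ! i"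
  then obtain i where i: "i < n" "b ! i \<noteq> c ! i" "\<And>j. j < n \<Longrightarrow> b ! j \<noteq> c ! j \<Longrightarrow> j = i" by blast
  have "c = flip i b"
  proof (rule nth_equalityI)
    fix j assume "j < length c"
    then have "j \<noteq> i \<Longrightarrow> c ! j = b ! j"
      using i(3)[of j] assms by metis
    moreover have "flip i b ! i = c ! i"
      using i(1,2) assms by (cases "b ! i"; cases "c ! i") (simp_all add: nth_flip_eq)
    ultimately show "c ! j = flip i b ! j"
      by (cases "j = i") simp_all
  qed (simp add: assms)
  then show "\<exists>i<n. c = flip i b" using i by blast
next
  assume "\<exists>i<n. c = flip i b"
  then obtain i where i: "i < n" "c = flip i b" by blast
  show "\<exists>!i. i < n \<and> b ! i \<noteq> c ! i"
  proof (rule ex1I[of _ i])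
    show "i < n \<and> b ! i \<noteq> c ! i"
      using i assms by (simp add: nth_flip_eq)
    show "j = i" if "j < n \<and> b ! j \<noteq> c ! j" for j
      using that i(2) nth_flip_neq[of i j b] by metis
  qed
qed

section \<open>Walks and shortest paths as sequences of flips\<close>

context
  fixes n :: nat and S :: "bit list set" and G :: "(bit list, bit list \<times> bit list) pre_digraph"
  assumes S: "\<And>b. b \<in> S \<Longrightarrow> length b = n"
    and G: "G = with_proj (hypercube n) \<restriction> S"
begin

lemma arc_iff: "(b, c) \<in> arcs G \<longleftrightarrow> b \<in> S \<and> c \<in> S \<and> (\<exists>i<n. c = flip i b)"
proof -
  have "(b, c) \<in> arcs G \<longleftrightarrow> b \<in> S \<and> c \<in> S \<and> length b = n \<and> length c = n \<and>
      (\<exists>!i. i < n \<and> b ! i \<noteq> c ! i)"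
    unfolding G hypercube_def induce_subgraph_def with_proj_def
    by (simp del: bit_not_zero_iff bit_not_one_iff) blast
  then show ?thesis
    using ex1_differing_iff_flip[of b n c] S[of b] S[of c] by metis
qed

text \<open>Every arc flips one position, so walks from \<open>u\<close> can be replaced by lists of
  positions.\<close>

lemma awalk_iff_flips_to:
  assumes "u \<in> S"
  shows "pre_digraph.awalk G u p v \<longleftrightarrow> (\<exists>is. p = flip_path u is \<and> flips_to S u is v)"
  using assms
proof (induction p arbitrary: u)
  case Nil
  have "(\<exists>is. [] = flip_path u is \<and> flips_to S u is v) \<longleftrightarrow> u = v"
    by (metis flip_path.simps flips_to.simps(1) list.distinct(1) list.exhaust)
  then show ?case
    using Nil by (simp add: pre_digraph.awalk_def pre_digraph.cas.simps) (simp add: G)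
next
  case (Cons e p)
  obtain b c where e: "e = (b, c)" by fastforce
  have "pre_digraph.awalk G u (e # p) v \<longleftrightarrow>
      b = u \<and> (b, c) \<in> arcs G \<and> pre_digraph.awalk G c p v"
    using Cons.prems arc_iff[of b c] unfolding pre_digraph.awalk_def pre_digraph.cas.simps e
    by (auto simp: G)
  also have "\<dots> \<longleftrightarrow> b = u \<and> (\<exists>i<n. c = flip i b \<and> c \<in> S \<and>
      (\<exists>is. p = flip_path c is \<and> flips_to S c is v))"
    using Cons arc_iff[of b c] by auto
  also have "\<dots> \<longleftrightarrow> (\<exists>is. e # p = flip_path u is \<and> flips_to S u is v)" (is "?L \<longleftrightarrow> ?R")
  proof
    assume ?L
    then obtain i "is" where "b = u" "i < n" "c = flip i b" "c \<in> S" "p = flip_path c is" "flips_to S c is v"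
      by blast
    then have "e # p = flip_path u (i # is) \<and> flips_to S u (i # is) v"
      using e S[OF Cons.prems] by simp
    then show ?R by blast
  next
    assume ?R
    then obtain js where js: "e # p = flip_path u js" "flips_to S u js v" by blast
    then obtain i "is" where "js = i # is" by (cases js) auto
    then show ?L
      using js e S[OF Cons.prems] by auto
  qed
  finally show ?case .
qed

text \<open>One flip repairs at most the position it touches, so no differing position may be
  missing from the list.\<close>

lemma differing_subset: "flips_to S u is v \<Longrightarrow> differing u v \<subseteq> set is"
proof (induction "is" arbitrary: u)
  case (Cons i "is")
  then have "differing (flip i u) v \<subseteq> set is" by simp
  moreover have "differing u v \<subseteq> insert i (differing (flip i u) v)"
    by (auto simp: differing_def)
  ultimately show ?case by auto
qed (simp add: differing_def)

lemma card_differing_le: "flips_to S u is v \<Longrightarrow> card (differing u v) \<le> length is"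
  by (meson List.finite_set card_length card_mono differing_subset order_trans)

lemma flips_to_shortest:
  assumes "flips_to S u is v" "length is = card (differing u v)"
  shows "distinct is" "set is = differing u v"
proof -
  have "card (set is) \<le> length is" by (rule card_length)
  then show "set is = differing u v"
    using differing_subset[OF assms(1)] assms(2) by (metis List.finite_set card_seteq)
  then show "distinct is" using assms(2) by (simp add: card_distinct)
qed

lemma nth_awalk_verts_flip_path:
  assumes "w \<in> set (pre_digraph.awalk_verts G u (flip_path u is))" "j \<notin> set is"
  shows "w ! j = u ! j"
  using assms
proof (induction "is" arbitrary: u)
  case (Cons i "is")
  then show ?case
    by (auto simp: pre_digraph.awalk_verts.simps G induce_subgraph_def with_proj_def)
qed (simp add: pre_digraph.awalk_verts.simps)

text \<open>A position flipped just once keeps its new letter from then on, so no later vertex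
  returns to the string left behind. This turns walks into paths, among which the shortest ones are
  counted.\<close>

lemma distinct_awalk_verts_flip_path:
  assumes "distinct is" "\<forall>i\<in>set is. i < length u"
  shows "distinct (pre_digraph.awalk_verts G u (flip_path u is))"
  using assms
proof (induction "is" arbitrary: u)
  case (Cons i "is")
  have "w ! i \<noteq> u ! i" if "w \<in> set (pre_digraph.awalk_verts G (flip i u) (flip_path (flip i u) is))" for w
    using nth_awalk_verts_flip_path[OF that, of i] Cons.prems by (auto simp: nth_flip_eq)
  moreover have "tail G (u, flip i u) = u" "head G (u, flip i u) = flip i u"
    by (auto simp: G induce_subgraph_def with_proj_def)
  ultimately show ?case
    using Cons by (auto simp: pre_digraph.awalk_verts.simps)
qed (simp add: pre_digraph.awalk_verts.simps)

lemma length_flip_path [simp]: "length (flip_path u is) = length is"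
  by (induction "is" arbitrary: u) auto

text \<open>Flips of \<open>u\<close> at different valid positions give different strings, so the
  arcs determine the positions one at a time. The range conditions matter: a flip outside the string
  changes nothing.\<close>

lemma flip_path_inject:
  assumes "flip_path u is = flip_path u js" "\<forall>i\<in>set is. i < length u" "\<forall>j\<in>set js. j < length u"
  shows "is = js"
  using assms
proof (induction "is" arbitrary: u js)
  case Nil
  then show ?case by (cases js) auto
next
  case (Cons i "is")
  then obtain j js' where js: "js = j # js'" by (cases js) auto
  have eq: "flip i u = flip j u" using Cons.prems js by simp
  have "i = j"
  proof (rule ccontr)
    assume "i \<noteq> j"
    then have "flip i u ! i = u ! i" unfolding eq by simp
    then show False using Cons.prems by (simp add: nth_flip_eq split: if_splits)
  qed
  then show ?case
    using Cons js by auto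
qed

text \<open>Hypothesis \<open>ex\<close> makes the Hamming distance the actual minimal length;
  otherwise a detour could be forced. The minimal paths are then the images, under the injective
  \<open>flip_path u\<close>, of the orderings that stay in \<open>S\<close>.\<close>

lemma num_shortest_paths_eq_card_flips:
  assumes "u \<in> S"
    and ex: "\<exists>is. distinct is \<and> set is = differing u v \<and> flips_to S u is v"
  shows "num_shortest_paths u v G =
    card {is. distinct is \<and> set is = differing u v \<and> flips_to S u is v}" (is "_ = card ?F")
proof -
  have less: "\<forall>i\<in>set is. i < length u" if "is \<in> ?F" for "is"
    using that by (auto simp: differing_def)
  have len: "length is = card (differing u v)" if "is \<in> ?F" for "is"
    using that distinct_card by fastforce
  have apath: "pre_digraph.apath G u (flip_path u is) v" if "is \<in> ?F" for "is"
    unfolding pre_digraph.apath_def awalk_iff_flips_to[OF assms(1)]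
    using that distinct_awalk_verts_flip_path[OF _ less[OF that]] by blast
  have ge: "card (differing u v) \<le> length p" if "pre_digraph.apath G u p v" for p
    using that card_differing_le unfolding pre_digraph.apath_def awalk_iff_flips_to[OF assms(1)] by auto
  obtain is0 where is0: "is0 \<in> ?F" using ex by blast
  have "is_arg_min length (\<lambda>q. pre_digraph.apath G u q v) p \<longleftrightarrow>
      pre_digraph.apath G u p v \<and> length p = card (differing u v)" for p
    using apath[OF is0] len[OF is0] ge unfolding is_arg_min_linorder
    by (metis length_flip_path order.antisym)
  also have "\<dots> p \<longleftrightarrow> p \<in> flip_path u ` ?F" for p
  proof
    assume p: "pre_digraph.apath G u p v \<and> length p = card (differing u v)"
    then obtain "is" where "p = flip_path u is" "flips_to S u is v"
      unfolding pre_digraph.apath_def awalk_iff_flips_to[OF assms(1)] by blast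
    then show "p \<in> flip_path u ` ?F"
      using p flips_to_shortest[of u "is" v] by auto
  next
    assume "p \<in> flip_path u ` ?F"
    then show "pre_digraph.apath G u p v \<and> length p = card (differing u v)"
      using apath len by auto
  qed
  finally have "{p. is_arg_min length (\<lambda>q. pre_digraph.apath G u q v) p} = flip_path u ` ?F"
    by blast
  then have "num_shortest_paths u v G = card (flip_path u ` ?F)"
    unfolding num_shortest_paths_def by simp
  also have "\<dots> = card ?F"
    by (rule card_image, rule inj_onI) (use flip_path_inject less in blast)
  finally show ?thesis .
qed

end

section \<open>Subgraphs defined by pairwise conflicts between positions\<close>

definition independent_strings :: "nat \<Rightarrow> (nat \<Rightarrow> nat \<Rightarrow> bool) \<Rightarrow> bit list set" where
  "independent_strings n R =
    {b. length b = n \<and> (\<forall>i<n. \<forall>j<n. R i j \<longrightarrow> b ! i = 0 \<or> b ! j = 0)}"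

text \<open>Only \<open>u\<close> is inspected: on the differing positions, a 1 of \<open>u\<close>
  is a letter to erase and a 0 one to create.\<close>

definition flip_before :: "(nat \<Rightarrow> nat \<Rightarrow> bool) \<Rightarrow> bit list \<Rightarrow> nat \<Rightarrow> nat \<Rightarrow> bool" where
  "flip_before R u i j \<longleftrightarrow> R i j \<and> u ! i = 1 \<and> u ! j = 0"

text \<open>Induction along the flips: flipping \<open>i\<close> first keeps the string admissible
  iff no remaining position must precede \<open>i\<close>, and the constraints among the remaining
  positions are the same for \<open>flip i u\<close> as for \<open>u\<close>.\<close>

lemma flips_to_iff_sorted_wrt:
  assumes sym: "symp R"
    and "u \<in> independent_strings n R" and v: "v \<in> independent_strings n R"
    and "distinct is" "set is = differing u v"
  shows "flips_to (independent_strings n R) u is v \<longleftrightarrow>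
    sorted_wrt (\<lambda>i j. \<not> flip_before R u j i) is"
  using assms(2,4,5)
proof (induction "is" arbitrary: u)
  case Nil
  then show ?case using v
    by (auto simp: differing_def independent_strings_def intro!: nth_equalityI)
next
  case (Cons i "is")
  let ?u = "flip i u"
  have len: "length u = n"
    using Cons.prems by (auto simp: independent_strings_def)
  have i: "i < n" "u ! i \<noteq> v ! i" "i \<notin> set is"
    using Cons.prems len by (auto simp: differing_def)
  have set: "set is = differing ?u v"
  proof -
    have "?u ! i = v ! i"
      using i len by (cases "u ! i"; cases "v ! i") (simp_all add: nth_flip_eq)
    then have "j \<in> differing ?u v \<longleftrightarrow> j \<in> differing u v - {i}" for j
      by (cases "j = i") (simp_all add: differing_def)
    then have "differing ?u v = differing u v - {i}" by blast
    then show ?thesis using Cons.prems by auto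
  qed
  have sorted: "sorted_wrt (\<lambda>i j. \<not> flip_before R ?u j i) is \<longleftrightarrow>
      sorted_wrt (\<lambda>i j. \<not> flip_before R u j i) is"
  proof (rule sorted_wrt_iff_on_set)
    fix j j' assume "j \<in> set is" "j' \<in> set is"
    then have "j \<noteq> i" "j' \<noteq> i" using i by blast+
    then show "\<not> flip_before R ?u j' j \<longleftrightarrow> \<not> flip_before R u j' j"
      by (simp add: flip_before_def)
  qed
  have valid: "?u \<in> independent_strings n R \<longleftrightarrow> (\<forall>j\<in>set is. \<not> flip_before R u j i)"
  proof
    assume L: "?u \<in> independent_strings n R"
    show "\<forall>j\<in>set is. \<not> flip_before R u j i"
    proof (intro ballI notI)
      fix j assume j: "j \<in> set is" "flip_before R u j i"
      have "j \<noteq> i" using j i by blast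
      then have "?u ! j = 1" "?u ! i = 1" "R j i"
        using j i len by (simp_all add: flip_before_def nth_flip_eq)
      moreover have "j < n" using j set len by (simp add: differing_def)
      ultimately show False using L i(1) by (auto simp: independent_strings_def)
    qed
  next
    assume R: "\<forall>j\<in>set is. \<not> flip_before R u j i"
    \<comment> \<open>If creating a one at \<open>i\<close> clashed with a one at \<open>b\<close>,
      then \<open>v\<close>, which has a 1 at \<open>i\<close>, would need a 0 at \<open>b\<close>;
      so \<open>b\<close> is still to be flipped, against the assumption on the remaining
      positions.\<close>
    have key: False if "R i b" "b < n" "?u ! i = 1" "?u ! b = 1" for b
    proof -
      have ui: "u ! i = 0" and vi: "v ! i = 1"
        using that(3) i(1,2) len by (cases "u ! i"; cases "v ! i"; simp add: nth_flip_eq)+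
      have vb: "v ! b = 0"
        using that(1,2) vi v i(1) by (auto simp: independent_strings_def)
      then have "b \<noteq> i" using vi by auto
      then have ub: "u ! b = 1" using that by simp
      then have "b \<in> set is"
        using vb that(2,4) len unfolding set by (simp add: differing_def)
      moreover have "flip_before R u b i"
        using sympD[OF sym that(1)] ui ub by (simp add: flip_before_def)
      ultimately show False using R by blast
    qed
    show "?u \<in> independent_strings n R"
    proof -
      have "?u ! a = 0 \<or> ?u ! b = 0" if "a < n" "b < n" "R a b" for a b
      proof (rule ccontr)
        assume "\<not> ?thesis"
        then have ones: "?u ! a = 1" "?u ! b = 1" by auto
        consider "a = i" | "b = i" | "a \<noteq> i" "b \<noteq> i" by blast
        then show False
        proof cases
          case 3
          then show False using ones that Cons.prems(1) by (auto simp: independent_strings_def)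
        qed (use key ones that sym in \<open>auto dest: sympD\<close>)
      qed
      then show ?thesis using len by (simp add: independent_strings_def)
    qed
  qed
  show ?case
    using Cons.IH[OF _ _ set] Cons.prems(2) sorted valid i len by auto
qed

text \<open>The count by orderings applies once some ordering attains the Hamming distance, and one
  always exists because \<open>flip_before\<close> only relates ones of \<open>u\<close> to zeros of
  \<open>u\<close>.\<close>

lemma num_shortest_paths_eq_card_linear_extensions:
  assumes sym: "symp R"
    and u: "u \<in> independent_strings n R" and v: "v \<in> independent_strings n R"
  shows "num_shortest_paths u v (with_proj (hypercube n) \<restriction> independent_strings n R) =
    card (linear_extensions (differing u v) (flip_before R u))"
proof -
  let ?D = "differing u v"
  have eq: "{is. distinct is \<and> set is = ?D \<and> flips_to (independent_strings n R) u is v} =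
      linear_extensions ?D (flip_before R u)"
    unfolding linear_extensions_def using flips_to_iff_sorted_wrt[OF sym u v] by auto
  \<comment> \<open>Erasing all ones of \<open>u\<close> first and then creating those of \<open>v\<close> never leaves the subgraph.\<close>
  obtain xs ys where xs: "distinct xs" "set xs = {i\<in>?D. u ! i = 1}"
    and ys: "distinct ys" "set ys = {i\<in>?D. u ! i = 0}"
    using finite_distinct_list[of "{i\<in>?D. u ! i = 1}"] finite_distinct_list[of "{i\<in>?D. u ! i = 0}"]
    by (auto simp: differing_def)
  \<comment> \<open>Positions with equal letters in \<open>u\<close> never constrain each other, so
    \<open>xs\<close> and \<open>ys\<close> may each be in any order.\<close>
  have "sorted_wrt (\<lambda>i j. \<not> flip_before R u j i) zs"
    if "\<forall>i\<in>set zs. \<forall>j\<in>set zs. u ! i = u ! j" for zs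
    unfolding sorted_wrt_iff_nth_less flip_before_def
    using that by (metis nth_mem order_less_trans zero_neq_one)
  then have "sorted_wrt (\<lambda>i j. \<not> flip_before R u j i) (xs @ ys)"
    unfolding sorted_wrt_append using xs ys by (simp add: flip_before_def)
  moreover have "distinct (xs @ ys)"
    unfolding distinct_append using xs ys by auto
  moreover have "set (xs @ ys) = ?D"
    unfolding set_append xs(2) ys(2) by (auto simp del: bit_not_zero_iff bit_not_one_iff) (metis bit_not_one_iff)
  ultimately have "xs @ ys \<in> linear_extensions ?D (flip_before R u)"
    unfolding linear_extensions_def by blast
  then have ex: "\<exists>is. distinct is \<and> set is = ?D \<and> flips_to (independent_strings n R) u is v"
    unfolding eq[symmetric] by blast
  show ?thesis
    unfolding eq[symmetric]
    by (rule num_shortest_paths_eq_card_flips[OF _ refl u ex]) (simp add: independent_strings_def)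
qed

section \<open>The Alternate Lucas cube\<close>

text \<open>A path on the positions whose last three form a triangle; since lists start at 0,
  \<open>n - 3\<close> and \<open>n - 1\<close> hold the letters numbered n-2 and n.\<close>

definition lucas_conflict :: "nat \<Rightarrow> nat \<Rightarrow> nat \<Rightarrow> bool" where
  "lucas_conflict n i j \<longleftrightarrow> j = Suc i \<or> i = Suc j \<or>
    i = n - 3 \<and> j = n - 1 \<or> i = n - 1 \<and> j = n - 3"

lemma symp_lucas_conflict: "symp (lucas_conflict n)"
  by (auto intro!: sympI simp: lucas_conflict_def)

lemma alternate_lucas_strings_eq:
  assumes "n \<ge> 3"
  shows "alternate_lucas_strings n = independent_strings n (lucas_conflict n)"
proof -
  have mult: "a * b = 0 \<longleftrightarrow> a = 0 \<or> b = 0" for a b :: bit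
    by (cases a; cases b) simp_all
  have "(\<forall>i\<in>{1..n - 1}. P (i - 1) i) \<longleftrightarrow> (\<forall>i. Suc i < n \<longrightarrow> P i (Suc i))" for P
  proof
    assume L: "\<forall>i\<in>{1..n - 1}. P (i - 1) i"
    show "\<forall>i. Suc i < n \<longrightarrow> P i (Suc i)"
    proof (intro allI impI)
      fix i assume "Suc i < n"
      then show "P i (Suc i)" using L[rule_format, of "Suc i"] by simp
    qed
  next
    assume R: "\<forall>i. Suc i < n \<longrightarrow> P i (Suc i)"
    show "\<forall>i\<in>{1..n - 1}. P (i - 1) i"
    proof
      fix i assume "i \<in> {1..n - 1}"
      then show "P (i - 1) i" using R[rule_format, of "i - 1"] assms by auto
    qed
  qed
  note shift = this[of "\<lambda>i j. b ! i = 0 \<or> b ! j = 0" for b :: "bit list"]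
  have "(\<forall>i<n. \<forall>j<n. lucas_conflict n i j \<longrightarrow> b ! i = 0 \<or> b ! j = 0) \<longleftrightarrow>
      (\<forall>i. Suc i < n \<longrightarrow> b ! i = 0 \<or> b ! Suc i = 0) \<and> (b ! (n - 3) = 0 \<or> b ! (n - 1) = 0)"
    (is "?L \<longleftrightarrow> ?R") for b :: "bit list"
  proof
    assume L: ?L
    show ?R
    proof (intro conjI allI impI)
      fix i assume "Suc i < n"
      then show "b ! i = 0 \<or> b ! Suc i = 0"
        using L[rule_format, of i "Suc i"] by (simp add: lucas_conflict_def)
    next
      show "b ! (n - 3) = 0 \<or> b ! (n - 1) = 0"
        using L[rule_format, of "n - 3" "n - 1"] assms by (simp add: lucas_conflict_def)
    qed
  next
    assume ?R
    then show ?L unfolding lucas_conflict_def by blast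
  qed
  then show ?thesis
    unfolding alternate_lucas_strings_def independent_strings_def mult shift by simp
qed

section \<open>Alternating strings with a short tail\<close>

definition zigzag :: "nat \<Rightarrow> nat \<Rightarrow> bit \<Rightarrow> bit \<Rightarrow> bit list \<Rightarrow> bit list" where
  "zigzag s k a b t = replicate s a @ concat (replicate k [b, a]) @ t"

lemma length_zigzag: "length (zigzag s k a b t) = 2 * k + s + length t"
  by (induction k) (auto simp: zigzag_def)

lemma nth_concat_replicate_pair:
  "i < 2 * k \<Longrightarrow> (concat (replicate k [a, b]) @ t) ! i = (if even i then a else b)"
proof (induction k arbitrary: i)
  case (Suc k)
  show ?case
  proof (cases "i < 2")
    case True
    then show ?thesis by (auto simp: less_2_cases_iff)
  next
    case False
    then obtain j where "i = Suc (Suc j)" by (metis add_2_eq_Suc le_Suc_ex not_less)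
    then show ?thesis using Suc by simp
  qed
qed simp

text \<open>The parity of \<open>i + s\<close> absorbs the optional leading letter, so one formula
  serves both parities of the length.\<close>

lemma nth_zigzag:
  assumes "s \<in> {0, 1}" "i < 2 * k + s"
  shows "zigzag s k a b t ! i = (if even (i + s) then b else a)"
proof (cases "i < s")
  case True
  then show ?thesis using assms by (auto simp: zigzag_def nth_append)
next
  case False
  then have "zigzag s k a b t ! i = (concat (replicate k [b, a]) @ t) ! (i - s)"
    by (simp add: zigzag_def nth_append)
  also have "\<dots> = (if even (i - s) then b else a)"
    using False assms by (intro nth_concat_replicate_pair) auto
  finally show ?thesis using False by simp
qed

lemma nth_zigzag_tail: "zigzag s k a b t ! (2 * k + s + j) = t ! j"
proof -
  have "zigzag s k a b t = zigzag s k a b [] @ t" by (simp add: zigzag_def)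
  then show ?thesis
    using length_zigzag[of s k a b "[]"] nth_append_length_plus by (metis add.right_neutral list.size(3))
qed

text \<open>\<open>a = 0 \<or> b = 0\<close> settles the alternating prefix,
  \<open>a = 0 \<or> x = 0\<close> the junction, since a nonempty prefix ends in \<open>a\<close>,
  and the last three conditions the triangle at the end.\<close>

lemma zigzag_in_independent_strings:
  assumes s: "s \<in> {0, 1}" and n: "n = 2 * k + s + 3" and "a = 0 \<or> b = 0" "a = 0 \<or> x = 0"
    and "x = 0 \<or> y = 0" "y = 0 \<or> z = 0" "x = 0 \<or> z = 0"
  shows "zigzag s k a b [x, y, z] \<in> independent_strings n (lucas_conflict n)"
proof -
  let ?m = "2 * k + s" and ?w = "zigzag s k a b [x, y, z]"
  have tail: "?w ! ?m = x" "?w ! Suc ?m = y" "?w ! Suc (Suc ?m) = z"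
    using nth_zigzag_tail[of s k a b "[x, y, z]" 0] nth_zigzag_tail[of s k a b "[x, y, z]" 1]
      nth_zigzag_tail[of s k a b "[x, y, z]" 2] by simp_all
  have suc: "?w ! i = 0 \<or> ?w ! Suc i = 0" if i: "Suc i < n" for i
  proof -
    consider "Suc i < ?m" | "Suc i = ?m" | "i = ?m" | "i = Suc ?m"
      using i n by linarith
    then show ?thesis
    proof cases
      case 1
      then show ?thesis using assms nth_zigzag[OF s, of i k] nth_zigzag[OF s, of "Suc i" k] by auto
    next
      case 2
      have "odd (i + s)" using 2 by presburger
      then have "?w ! i = a" using 2 nth_zigzag[OF s, of i k] by simp
      then show ?thesis using assms tail 2 by auto
    qed (use tail assms in auto)
  qed
  have "?w ! i = 0 \<or> ?w ! j = 0" if conflict: "lucas_conflict n i j" and "i < n" "j < n" for i j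
  proof -
    have "n - 3 = ?m" "n - 1 = Suc (Suc ?m)" using n by auto
    then consider "j = Suc i" | "i = Suc j" | "i = ?m" "j = Suc (Suc ?m)" | "j = ?m" "i = Suc (Suc ?m)"
      using conflict unfolding lucas_conflict_def by metis
    then show ?thesis using suc that tail assms by cases auto
  qed
  then show ?thesis
    using n by (simp add: independent_strings_def length_zigzag)
qed

text \<open>For odd \<open>s\<close> this is the fence itself; for even \<open>s\<close> its order
  is reversed, which list reversal undoes.\<close>

lemma euler_number_linear_extensions_parity:
  "card (linear_extensions {1..m} (\<lambda>i j. odd (i + s) \<and> (j = Suc i \<or> i = Suc j))) = euler_number m"
proof (cases "odd s")
  case True
  then have "(\<lambda>i j. odd (i + s) \<and> (j = Suc i \<or> i = Suc j)) = even_before_odd"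
    by (auto simp: fun_eq_iff even_before_odd_def)
  then show ?thesis by (simp only: euler_number_linear_extensions)
next
  case False
  then have "(\<lambda>i j. odd (i + s) \<and> (j = Suc i \<or> i = Suc j)) = (\<lambda>i j. even_before_odd j i)"
    by (auto simp: fun_eq_iff even_before_odd_def)
  then show ?thesis
    by (simp only: card_linear_extensions_converse[of _ even_before_odd] euler_number_linear_extensions)
qed

lemma linear_extensions_pair:
  assumes "x \<noteq> y" "r x y" "\<not> r y x"
  shows "linear_extensions {x, y} r = {[x, y]}"
proof (intro set_eqI iffI)
  fix zs assume zs: "zs \<in> linear_extensions {x, y} r"
  then have "length zs = Suc (Suc 0)" using length_linear_extension[OF zs] assms(1) by simp
  then obtain a b where "zs = [a, b]" by (auto simp: length_Suc_conv)
  then show "zs \<in> {[x, y]}"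
    using zs assms by (auto simp: linear_extensions_def doubleton_eq_iff)
qed (use assms in \<open>auto simp: linear_extensions_def\<close>)

section \<open>Counting shortest paths for the four pairs of endpoints\<close>

context
  fixes n k s m :: nat
  assumes s: "s \<in> {0, 1}" and n: "n = 2 * k + 3 + s" and m: "m = 2 * k + s"
begin

text \<open>Here \<open>m\<close> is the length of the alternating prefix. Position \<open>m\<close>
  has the parity of a 1 in the source string, so a tail beginning with 1 continues the
  zigzag.\<close>

lemma even_m: "even (m + s)"
  using m by simp

lemma nth_zigzag_m:
  "i < m \<Longrightarrow> zigzag s k a b t ! i = (if even (i + s) then b else a)"
  "zigzag s k a b [x, y, z] ! m = x"
  "zigzag s k a b [x, y, z] ! Suc m = y"
  "zigzag s k a b [x, y, z] ! Suc (Suc m) = z"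
  using nth_zigzag[OF s] nth_zigzag_tail[of s k a b "[x, y, z]" 0]
    nth_zigzag_tail[of s k a b "[x, y, z]" 1] nth_zigzag_tail[of s k a b "[x, y, z]" 2]
  by (simp_all add: m)

text \<open>Exchanging \<open>a\<close> and \<open>b\<close> changes every prefix letter. Each tail
  position is a conditional singleton, so that concrete letters reduce the set by
  simplification.\<close>

lemma differing_zigzag:
  assumes "a \<noteq> b"
  shows "differing (zigzag s k a b [x, y, z]) (zigzag s k b a [x', y', z']) =
    {..<m} \<union> {i. i = m \<and> x \<noteq> x'} \<union> {i. i = Suc m \<and> y \<noteq> y'} \<union> {i. i = Suc (Suc m) \<and> z \<noteq> z'}"
    (is "?D = ?S")
proof -
  have "i \<in> ?D \<longleftrightarrow> i \<in> ?S" for i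
  proof -
    consider "i < m" | "i = m" | "i = Suc m" | "i = Suc (Suc m)" | "i \<ge> m + 3" by linarith
    then show ?thesis
      using assms by cases (auto simp: differing_def length_zigzag nth_zigzag_m simp flip: m)
  qed
  then show ?thesis by blast
qed

text \<open>A nonempty target prefix ends in 1, hence its tail is taken to start with 0; a nonempty
  source prefix ends in 0 and lets its tail start with either letter.\<close>

lemma num_shortest_paths_zigzag:
  assumes "x = 0 \<or> y = 0" "y = 0 \<or> z = 0" "x = 0 \<or> z = 0" "y' = 0 \<or> z' = 0"
  shows "num_shortest_paths (zigzag s k 0 1 [x, y, z]) (zigzag s k 1 0 [0, y', z'])
      (alternate_lucas_cube n) =
    card (linear_extensions (differing (zigzag s k 0 1 [x, y, z]) (zigzag s k 1 0 [0, y', z']))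
      (flip_before (lucas_conflict n) (zigzag s k 0 1 [x, y, z])))"
  unfolding alternate_lucas_cube_def
  by (subst alternate_lucas_strings_eq,
      use n in simp,
      intro num_shortest_paths_eq_card_linear_extensions symp_lucas_conflict
        zigzag_in_independent_strings s)
    (use n assms in auto)

lemma lucas_conflict_iff:
  "lucas_conflict n i j \<longleftrightarrow> j = Suc i \<or> i = Suc j \<or>
    i = m \<and> j = Suc (Suc m) \<or> i = Suc (Suc m) \<and> j = m"
  using n m by (auto simp: lucas_conflict_def)

text \<open>Position \<open>m + 1\<close> is 0 in both strings and is skipped, but the extra
  conflict between \<open>m\<close> and \<open>m + 2\<close> bridges the gap: the flipped positions
  still form a zigzag, of \<open>m + 2 = n - 1\<close> elements.\<close>

lemma num_shortest_paths_100_001: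
  "num_shortest_paths (zigzag s k 0 1 [1, 0, 0]) (zigzag s k 1 0 [0, 0, 1])
    (alternate_lucas_cube n) = euler_number (n - 1)"
proof -
  let ?u = "zigzag s k 0 1 [1, 0, 0]" and ?v = "zigzag s k 1 0 [0, 0, 1]"
  \<comment> \<open>Shifting \<open>0..m\<close> by one and fixing \<open>m + 2\<close> closes the
    gap, giving \<open>1..m + 2\<close>.\<close>
  define f where "f i = (if i = Suc (Suc m) then Suc (Suc m) else Suc i)" for i
  have D: "differing ?u ?v = insert (Suc (Suc m)) {..m}"
    by (auto simp: differing_zigzag)
  \<comment> \<open>By parity alone \<open>m + 2\<close> would carry a 1; the source has a 0
    there.\<close>
  have u: "?u ! i = (if i \<noteq> Suc (Suc m) \<and> even (i + s) then 1 else 0)"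
    if "i \<in> insert (Suc (Suc m)) {..m}" for i
    using that even_m by (cases "i = m") (auto simp: nth_zigzag_m)
  have "card (linear_extensions (differing ?u ?v) (flip_before (lucas_conflict n) ?u)) =
      card (linear_extensions {1..n - 1} (\<lambda>i j. odd (i + s) \<and> (j = Suc i \<or> i = Suc j)))"
    unfolding D
  proof (rule card_linear_extensions_bij_betw)
    show "bij_betw f (insert (Suc (Suc m)) {..m}) {1..n - 1}"
      by (rule bij_betw_byWitness[where f' = "\<lambda>i. if i = Suc (Suc m) then Suc (Suc m) else i - 1"])
        (use n m in \<open>auto simp: f_def\<close>)
    fix i j assume ij: "i \<in> insert (Suc (Suc m)) {..m}" "j \<in> insert (Suc (Suc m)) {..m}"
    show "flip_before (lucas_conflict n) ?u i j \<longleftrightarrow> odd (f i + s) \<and> (f j = Suc (f i) \<or> f i = Suc (f j))"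
      unfolding flip_before_def lucas_conflict_iff u[OF ij(1)] u[OF ij(2)]
      using ij even_m by (auto simp: f_def)
  qed
  then show ?thesis
    unfolding euler_number_linear_extensions_parity by (simp add: num_shortest_paths_zigzag)
qed

text \<open>Position \<open>m + 2\<close> stays 0, so the flipped positions are
  \<open>0..m + 1\<close>, where conflicts join neighbours only and the letters of the source
  alternate throughout: a zigzag of \<open>n - 1\<close> elements.\<close>

lemma num_shortest_paths_100_010:
  "num_shortest_paths (zigzag s k 0 1 [1, 0, 0]) (zigzag s k 1 0 [0, 1, 0])
    (alternate_lucas_cube n) = euler_number (n - 1)"
proof -
  let ?u = "zigzag s k 0 1 [1, 0, 0]" and ?v = "zigzag s k 1 0 [0, 1, 0]"
  have D: "differing ?u ?v = {..Suc m}"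
    by (auto simp: differing_zigzag)
  have u: "?u ! i = (if even (i + s) then 1 else 0)" if "i \<in> {..Suc m}" for i
    using that even_m by (cases "i = m"; cases "i = Suc m") (auto simp: nth_zigzag_m)
  have "card (linear_extensions (differing ?u ?v) (flip_before (lucas_conflict n) ?u)) =
      card (linear_extensions {1..n - 1} (\<lambda>i j. odd (i + s) \<and> (j = Suc i \<or> i = Suc j)))"
    unfolding D
  proof (rule card_linear_extensions_bij_betw)
    show "bij_betw Suc {..Suc m} {1..n - 1}"
      by (rule bij_betw_byWitness[where f' = "\<lambda>i. i - 1"]) (use n m in auto)
    fix i j assume ij: "i \<in> {..Suc m}" "j \<in> {..Suc m}"
    show "flip_before (lucas_conflict n) ?u i j \<longleftrightarrow>
        odd (Suc i + s) \<and> (Suc j = Suc (Suc i) \<or> Suc i = Suc (Suc j))"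
      unfolding flip_before_def lucas_conflict_iff u[OF ij(1)] u[OF ij(2)]
      using ij by auto
  qed
  then show ?thesis
    unfolding euler_number_linear_extensions_parity by (simp add: num_shortest_paths_zigzag)
qed

text \<open>Position \<open>m\<close> stays 0, so the last two positions do not interact with the first \<open>m\<close>.\<close>

lemma num_shortest_paths_0:
  assumes "y \<noteq> z"
  shows "num_shortest_paths (zigzag s k 0 1 [0, y, z]) (zigzag s k 1 0 [0, z, y])
    (alternate_lucas_cube n) = ((n - 1) choose 2) * euler_number (n - 3)"
proof -
  let ?u = "zigzag s k 0 1 [0, y, z]" and ?v = "zigzag s k 1 0 [0, z, y]"
  let ?B = "{Suc m, Suc (Suc m)}" and ?r = "flip_before (lucas_conflict n) ?u"
  \<comment> \<open>The pair is listed first so that the shuffle lemma yields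
    \<open>(2 + m) choose 2\<close>.\<close>
  have D: "differing ?u ?v = ?B \<union> {..<m}"
    using assms by (auto simp: differing_zigzag)
  have u: "?u ! i = (if even (i + s) then 1 else 0)" if "i \<in> {..<m}" for i
    using that by (simp add: nth_zigzag_m)
  \<comment> \<open>The two tail positions conflict, so the 1 must be erased before the other is
    created; the value of \<open>y\<close> decides which position comes first.\<close>
  have "card (linear_extensions ?B ?r) = 1"
  proof (cases y)
    case zero
    have "linear_extensions {Suc (Suc m), Suc m} ?r = {[Suc (Suc m), Suc m]}"
      by (rule linear_extensions_pair)
        (use zero assms in \<open>auto simp: flip_before_def lucas_conflict_iff nth_zigzag_m\<close>)
    then show ?thesis by (simp add: insert_commute)
  next
    case one
    have "linear_extensions ?B ?r = {[Suc m, Suc (Suc m)]}"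
      by (rule linear_extensions_pair)
        (use one assms in \<open>auto simp: flip_before_def lucas_conflict_iff nth_zigzag_m\<close>)
    then show ?thesis by simp
  qed
  moreover have "card (linear_extensions {..<m} ?r) =
      card (linear_extensions {1..m} (\<lambda>i j. odd (i + s) \<and> (j = Suc i \<or> i = Suc j)))"
  proof (rule card_linear_extensions_bij_betw)
    show "bij_betw Suc {..<m} {1..m}"
      by (rule bij_betw_byWitness[where f' = "\<lambda>i. i - 1"]) auto
    fix i j assume ij: "i \<in> {..<m}" "j \<in> {..<m}"
    show "?r i j \<longleftrightarrow> odd (Suc i + s) \<and> (Suc j = Suc (Suc i) \<or> Suc i = Suc (Suc j))"
      unfolding flip_before_def lucas_conflict_iff u[OF ij(1)] u[OF ij(2)]
      using ij by auto
  qed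
  moreover have "card (linear_extensions (?B \<union> {..<m}) ?r) =
      ((card ?B + card {..<m}) choose card ?B) *
        card (linear_extensions ?B ?r) * card (linear_extensions {..<m} ?r)"
    by (rule card_linear_extensions_Un) (auto simp: flip_before_def lucas_conflict_iff)
  moreover have "card ?B = 2" by simp
  ultimately have "card (linear_extensions (differing ?u ?v) ?r) = ((2 + m) choose 2) * euler_number m"
    unfolding D euler_number_linear_extensions_parity by (simp only: card_lessThan mult_1_right)
  moreover have "y = 0 \<or> z = 0"
    using assms by (cases y; cases z) auto
  moreover have "n - 1 = 2 + m" "n - 3 = m"
    using n m by auto
  ultimately show ?thesis
    by (simp add: num_shortest_paths_zigzag disj_commute)
qed

end

theorem theorem3:
  fixes n k s :: nat
  assumes "n \<ge> 4" and "s \<in> {0, 1}" and "n = 2 * k + 3 + s"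
  shows
    "num_shortest_paths (replicate s 0 @ concat (replicate k [1, 0]) @ [1, 0, 0])
       (replicate s 1 @ concat (replicate k [0, 1]) @ [0, 0, 1]) (alternate_lucas_cube n)
     = euler_number (n - 1) \<and>
     num_shortest_paths (replicate s 0 @ concat (replicate k [1, 0]) @ [1, 0, 0])
       (replicate s 1 @ concat (replicate k [0, 1]) @ [0, 1, 0]) (alternate_lucas_cube n)
     = euler_number (n - 1) \<and>
     num_shortest_paths (replicate s 0 @ concat (replicate k [1, 0]) @ [0, 0, 1])
       (replicate s 1 @ concat (replicate k [0, 1]) @ [0, 1, 0]) (alternate_lucas_cube n)
     = ((n - 1) choose 2) * euler_number (n - 3) \<and>
     num_shortest_paths (replicate s 0 @ concat (replicate k [1, 0]) @ [0, 1, 0])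
       (replicate s 1 @ concat (replicate k [0, 1]) @ [0, 0, 1]) (alternate_lucas_cube n)
     = ((n - 1) choose 2) * euler_number (n - 3)"
  \<comment> \<open>The two directions of the tail swap, \<open>001\<close> to \<open>010\<close>
    and back, give the last two counts.\<close>
  using num_shortest_paths_100_001[OF assms(2,3) refl] num_shortest_paths_100_010[OF assms(2,3) refl]
    num_shortest_paths_0[OF assms(2,3) refl, of 0 1] num_shortest_paths_0[OF assms(2,3) refl, of 1 0]
  unfolding zigzag_def by simp

end
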